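(* Let $G$ be a regular $\mathbb{R}$-factorizable paratopological group. Then for every subgroup $H$ of $G$ (with the subspace topology), $H$ is $\mathbb{R}$-factorizable if and only if $H$ is $z$-embedded in $G$.
   Context: A paratopological group is a group with a topology such that multiplication $G\times G\to G$ is jointly continuous (inversion need not be continuous). "Regular" means $T_3+T_1$: the space is $T_1$ and points can be separated from closed sets not containing them by disjoint open sets. A paratopological group $G$ is $\mathbb{R}$-factorizable if for every continuous function $\varphi\colon G\to\mathbb{R}$ there exist a continuous homomorphism $\pi\colon G\to K$ onto a second-countable paratopological group $K$ (no separation axiom imposed on $K$) and a continuous function $h\colon K\to\mathbb{R}$ such that $\varphi=h\circ\pi$. A zero-set in a space $X$ is a set of the form $\varphi^{-1}(0)$ with $\varphi\colon X\to\mathbb{R}$ continuous. A subspace $Y$ of a space $X$ is $z$-embedded in $X$ if for every zero-set $Z$ in $Y$ there exists a zero-set $C$ in $X$ such that $Z=C\cap Y$. *)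

theory Defs
  imports "HOL-Algebra.Group" "HOL-Analysis.Analysis"
begin

locale paratopological_group = group G for G (structure) +
  fixes T :: "'a topology"
  assumes topspace_eq_carrier: "topspace T = carrier G"
    and continuous_mult: "continuous_map (prod_topology T T) T (\<lambda>(x, y). x \<otimes> y)"

definition factors_through ::
  "('a, 'm) monoid_scheme \<Rightarrow> 'a topology \<Rightarrow> ('b, 'n) monoid_scheme \<Rightarrow> 'b topology
     \<Rightarrow> ('a \<Rightarrow> real) \<Rightarrow> bool" where
  "factors_through G T K TK \<phi> \<longleftrightarrow>
     (\<exists>\<pi> h. \<pi> \<in> epi G K \<and> continuous_map T TK \<pi> \<and> continuous_map TK euclideanreal h \<and>
            (\<forall>x \<in> carrier G. \<phi> x = h (\<pi> x)))"

text \<open>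
  HOL cannot quantify existentially over the type of the elements of \<open>K\<close>. Since \<open>K\<close> is a
  surjective image of \<open>G\<close>, it can always be transported to a subset of the type of elements of
  \<open>G\<close>, so taking \<open>K\<close> on that type loses no generality; see \<open>R_factorizableI\<close> below.
\<close>

definition R_factorizable :: "('a, 'm) monoid_scheme \<Rightarrow> 'a topology \<Rightarrow> bool" where
  "R_factorizable G T \<longleftrightarrow>
     (\<forall>\<phi>. continuous_map T euclideanreal \<phi> \<longrightarrow>
        (\<exists>(K :: 'a monoid) TK. paratopological_group K TK \<and> second_countable TK \<and>
           factors_through G T K TK \<phi>))"

definition zero_set_in :: "'a topology \<Rightarrow> 'a set \<Rightarrow> bool" where
  "zero_set_in X Z \<longleftrightarrow>
     (\<exists>\<phi>. continuous_map X euclideanreal \<phi> \<and> Z = {x \<in> topspace X. \<phi> x = 0})"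

definition z_embedded_in :: "'a topology \<Rightarrow> 'a set \<Rightarrow> bool" where
  "z_embedded_in X Y \<longleftrightarrow>
     Y \<subseteq> topspace X \<and>
     (\<forall>Z. zero_set_in (subtopology X Y) Z \<longrightarrow> (\<exists>C. zero_set_in X C \<and> Z = C \<inter> Y))"

lemma factors_through_transport:
  fixes G :: "('a, 'm) monoid_scheme" and K :: "('b, 'n) monoid_scheme"
  assumes topG: "topspace T = carrier G"
    and K: "paratopological_group K TK" and sc: "second_countable TK"
    and fac: "factors_through G T K TK \<phi>"
  shows "\<exists>(L :: 'a monoid) TL. paratopological_group L TL \<and> second_countable TL \<and>
           factors_through G T L TL \<phi>"
proof -
  interpret K: paratopological_group K TK by (rule K)
  obtain \<pi> h where hom: "\<pi> \<in> hom G K" and sur: "\<pi> ` carrier G = carrier K"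
    and cpi: "continuous_map T TK \<pi>" and ch: "continuous_map TK euclideanreal h"
    and eq: "\<And>x. x \<in> carrier G \<Longrightarrow> \<phi> x = h (\<pi> x)"
    using fac by (auto simp: factors_through_def epi_def)
  define s where "s = inv_into (carrier G) \<pi>"
  have ps: "\<pi> (s y) = y" if "y \<in> carrier K" for y
    using that sur by (simp add: s_def f_inv_into_f)
  define S where "S = s ` carrier K"
  have sp: "s (\<pi> x) = x" and piS: "\<pi> x \<in> carrier K" if "x \<in> S" for x
    using that ps by (auto simp: S_def)
  define L :: "'a monoid"
    where "L = \<lparr>carrier = S, monoid.mult = \<lambda>x y. s (\<pi> x \<otimes>\<^bsub>K\<^esub> \<pi> y), one = s \<one>\<^bsub>K\<^esub>\<rparr>"
  define TL where "TL = pullback_topology S \<pi> TK"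
  have sS: "s y \<in> S" if "y \<in> carrier K" for y using that by (simp add: S_def)
  have topL: "topspace TL = S"
    unfolding TL_def topspace_pullback_topology using piS K.topspace_eq_carrier by auto
  have cs: "continuous_map TK TL s"
    unfolding TL_def
  proof (rule continuous_map_pullback')
    show "continuous_map TK TK (\<pi> \<circ> s)"
      by (rule continuous_map_eq[OF continuous_map_id])
        (auto simp: ps K.topspace_eq_carrier)
    show "topspace TK \<subseteq> s -` S" using sS K.topspace_eq_carrier by auto
  qed
  have cp: "continuous_map TL TK \<pi>"
    using continuous_map_pullback[OF continuous_map_id[of TK], of S \<pi>] by (simp add: TL_def)
  have grpL: "group L"
  proof (rule groupI)
    fix x assume x: "x \<in> carrier L"
    then have "s (inv\<^bsub>K\<^esub> \<pi> x) \<in> S" "s (\<pi> (s (inv\<^bsub>K\<^esub> \<pi> x)) \<otimes>\<^bsub>K\<^esub> \<pi> x) = s \<one>\<^bsub>K\<^esub>"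
      by (auto simp: L_def ps piS sS)
    then show "\<exists>y\<in>carrier L. y \<otimes>\<^bsub>L\<^esub> x = \<one>\<^bsub>L\<^esub>" by (auto simp: L_def)
  qed (auto simp: L_def sS ps piS sp K.m_assoc)
  have "continuous_map (prod_topology TL TL) TL (\<lambda>(x, y). x \<otimes>\<^bsub>L\<^esub> y)"
  proof -
    have "continuous_map (prod_topology TL TL) (prod_topology TK TK) (\<lambda>(x, y). (\<pi> x, \<pi> y))"
      using cp by (simp add: continuous_map_prod_top)
    from continuous_map_compose[OF continuous_map_compose[OF this K.continuous_mult] cs]
    show ?thesis by (simp add: L_def o_def case_prod_unfold)
  qed
  then have pL: "paratopological_group L TL"
    using grpL topL
    by (simp add: paratopological_group_def paratopological_group_axioms_def L_def)
  have "homeomorphic_maps TK TL s \<pi>"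
    using cs cp by (auto simp: homeomorphic_maps_def topL sp ps K.topspace_eq_carrier)
  then have scL: "second_countable TL"
    using sc homeomorphic_space_second_countability homeomorphic_space_def by blast
  have "factors_through G T L TL \<phi>"
    unfolding factors_through_def
  proof (intro exI conjI ballI)
    have pic: "\<pi> x \<in> carrier K" if "x \<in> carrier G" for x using that sur by auto
    have "s \<circ> \<pi> \<in> hom G L"
      using hom by (auto simp: hom_def L_def sS ps pic)
    moreover have "(s \<circ> \<pi>) ` carrier G = carrier L"
      unfolding image_comp[symmetric] sur by (simp add: L_def S_def)
    ultimately show "s \<circ> \<pi> \<in> epi G L" by (simp add: epi_def)
    show "continuous_map T TL (s \<circ> \<pi>)" using cpi cs continuous_map_compose by blast
    show "continuous_map TL euclideanreal (h \<circ> \<pi>)" using cp ch continuous_map_compose by blast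
    show "\<phi> x = (h \<circ> \<pi>) ((s \<circ> \<pi>) x)" if "x \<in> carrier G" for x
      using that by (simp add: eq ps pic)
  qed
  with pL scL show ?thesis by blast
qed

lemma R_factorizableI:
  fixes G :: "('a, 'm) monoid_scheme" and T :: "'a topology"
  assumes "topspace T = carrier G"
    and "\<And>\<phi>. continuous_map T euclideanreal \<phi> \<Longrightarrow>
           \<exists>(K :: 'b monoid) TK. paratopological_group K TK \<and> second_countable TK \<and>
             factors_through G T K TK \<phi>"
  shows "R_factorizable G T"
  unfolding R_factorizable_def
  using assms factors_through_transport[OF assms(1)] by blast

end

theory Submission
  imports Defs
begin

text \<open>
  Call a second-countable paratopological group topology on \<open>G\<close> that is coarser than the given one
  admissible. As \<open>K\<close> need not be Hausdorff, \<open>G\<close> is \<open>\<real>\<close>-factorizable iff each continuous real function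
  is continuous for some admissible topology. Countably many admissible topologies have an admissible
  supremum, which yields factorizations on a \<open>z\<close>-embedded subgroup.

  Conversely, let \<open>f\<close> be continuous on \<open>H\<close> for an admissible topology of \<open>H\<close>. A countable
  base of identity neighbourhoods of the latter extends to open sets of \<open>G\<close>, each of which contains a
  cozero neighbourhood of the identity, because regular paratopological groups are completely
  regular (Banakh and Ravsky). By factorizability these cozero sets are open for admissible
  topologies, so by the Lindelof property countably many of their translates suffice to
  cut out \<open>{f \<noteq> 0}\<close> on \<open>H\<close>, and a countable union of cozero sets is cozero.
\<close>

section \<open>Zero-sets and second-countable spaces\<close>

lemma zero_set_in_topspace: "zero_set_in X (topspace X)"
  unfolding zero_set_in_def by (intro exI[of _ "\<lambda>_. 0"]) auto

lemma zero_set_in_le: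
  assumes "continuous_map X euclideanreal f"
  shows "zero_set_in X {x \<in> topspace X. f x \<le> a}"
  unfolding zero_set_in_def
proof (intro exI conjI)
  show "continuous_map X euclideanreal (\<lambda>x. max (f x - a) 0)"
    by (intro continuous_intros assms)
qed (auto simp: max_def)

lemma zero_set_in_ge:
  assumes "continuous_map X euclideanreal f"
  shows "zero_set_in X {x \<in> topspace X. f x \<ge> a}"
  using zero_set_in_le[of X "\<lambda>x. - f x" "- a"] assms by (simp add: continuous_map_minus)

text \<open>The sum of \<open>min \<bar>f n x\<bar> 1 * (1/2)^n\<close> converges uniformly, hence
  is continuous, and a convergent sum of nonnegative terms vanishes exactly where every term
  does.\<close>

lemma zero_set_in_INT:
  assumes "\<And>n::nat. zero_set_in X (Z n)"
  shows "zero_set_in X (\<Inter>n. Z n)"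
proof -
  obtain f where cf: "\<And>n. continuous_map X euclideanreal (f n)"
    and Z: "\<And>n. Z n = {x \<in> topspace X. f n x = 0}"
    using assms unfolding zero_set_in_def by metis
  define g where "g n x = min \<bar>f n x\<bar> 1 * (1/2)^n" for n x
  have g0: "0 \<le> g n x" and g1: "g n x \<le> (1/2)^n" for n x
    by (auto simp: g_def mult_left_le_one_le)
  have sm: "summable (\<lambda>n. g n x)" for x
    by (rule summable_comparison_test[of _ "\<lambda>n. (1/2)^n"]) (use g0 g1 in auto)
  have cg: "continuous_map X euclideanreal (g n)" for n
    unfolding g_def
    by (intro continuous_map_real_mult continuous_map_real_min continuous_map_real_abs cf) auto
  have ul: "uniform_limit UNIV (\<lambda>n x. \<Sum>i<n. g i x) (\<lambda>x. \<Sum>i. g i x) sequentially"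
    by (rule Weierstrass_m_test[of _ _ "\<lambda>n. (1/2)^n"]) (use g0 g1 in auto)
  have "continuous_map X euclideanreal (\<lambda>x. \<Sum>i. g i x)"
    unfolding mtopology_is_euclidean[symmetric]
  proof (rule Met_TC.continuous_map_uniform_limit[where F = sequentially
        and f = "\<lambda>n x. \<Sum>i<n. g i x"])
    show "\<forall>\<^sub>F n in sequentially. continuous_map X Met_TC.mtopology (\<lambda>x. \<Sum>i<n. g i x)"
      unfolding mtopology_is_euclidean
      by (intro always_eventually allI continuous_map_sum cg) auto
    show "\<forall>\<^sub>F n in sequentially. \<forall>x\<in>topspace X. (\<Sum>i. g i x) \<in> UNIV
        \<and> dist (\<Sum>i<n. g i x) (\<Sum>i. g i x) < e" if "0 < e" for e
      using uniform_limitD[OF ul that] by eventually_elim simp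
  qed simp
  moreover have "(\<Inter>n. Z n) = {x \<in> topspace X. (\<Sum>i. g i x) = 0}"
    using suminf_eq_zero_iff[OF sm] g0 by (auto simp: Z g_def min_def split: if_splits)
  ultimately show ?thesis unfolding zero_set_in_def by blast
qed

lemma zero_set_in_Inter:
  assumes "countable \<Z>" "\<And>Z. Z \<in> \<Z> \<Longrightarrow> zero_set_in X Z"
  shows "zero_set_in X (topspace X \<inter> \<Inter>\<Z>)"
proof -
  \<comment> \<open>Adding the whole space makes the family nonempty, so that the naturals enumerate
    it, and covers the case of an empty family.\<close>
  define Z where "Z = from_nat_into (insert (topspace X) \<Z>)"
  have range: "range Z = insert (topspace X) \<Z>"
    unfolding Z_def by (rule range_from_nat_into) (use assms in auto)
  have "zero_set_in X (\<Inter>n. Z n)"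
  proof (rule zero_set_in_INT)
    show "zero_set_in X (Z n)" for n
      using range assms(2) zero_set_in_topspace rangeI[of Z n] by (metis insertE)
  qed
  then show ?thesis by (simp add: range)
qed

text \<open>The union is second-countable as a subspace, hence Lindelof. The indexed form returns
  the chosen indices, which later serve as centres of translates.\<close>

lemma second_countable_countable_subcover:
  assumes "second_countable X" "\<And>i. i \<in> I \<Longrightarrow> openin X (E i)"
  obtains C where "countable C" "C \<subseteq> I" "(\<Union>i\<in>C. E i) = (\<Union>i\<in>I. E i)"
proof -
  let ?W = "\<Union>i\<in>I. E i"
  have "Lindelof_space (subtopology X ?W)"
    by (intro second_countable_imp_Lindelof_space second_countable_subtopology assms)
  moreover have "?W \<subseteq> topspace X" using assms(2) openin_subset by fastforce
  ultimately have "\<forall>\<U>. (\<forall>U\<in>\<U>. openin X U) \<and> ?W \<subseteq> \<Union>\<U>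
      \<longrightarrow> (\<exists>\<V>. countable \<V> \<and> \<V> \<subseteq> \<U> \<and> ?W \<subseteq> \<Union>\<V>)"
    by (simp only: Lindelof_space_subtopology_subset)
  from this[rule_format, of "E ` I"] obtain \<V>
    where "countable \<V>" "\<V> \<subseteq> E ` I" "?W \<subseteq> \<Union>\<V>"
    using assms(2) by auto
  then obtain C where "C \<subseteq> I" "countable C" "\<V> = E ` C"
    using countable_subset_image by metis
  then show ?thesis using that[of C] \<open>?W \<subseteq> \<Union>\<V>\<close> by auto
qed

lemma second_countable_topology_generated_by:
  assumes "countable \<G>"
  shows "second_countable (topology_generated_by \<G>)"
proof -
  \<comment> \<open>Finite intersections of generators form a countable base. The empty intersection
    is excluded, since it would be the whole type.\<close>
  define \<B> where "\<B> = Inter ` {\<F>. finite \<F> \<and> \<F> \<subseteq> \<G> \<and> \<F> \<noteq> {}}"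
  have "countable {\<F>. finite \<F> \<and> \<F> \<subseteq> \<G>}"
    by (rule countable_Collect_finite_subset[OF assms])
  then have "countable \<B>"
    unfolding \<B>_def by (intro countable_image) (auto elim: countable_subset[rotated])
  moreover have "openin (topology_generated_by \<G>) = arbitrary union_of (\<lambda>V. V \<in> \<B>)"
  proof -
    have "(finite' intersection_of (\<lambda>x. x \<in> \<G>)) = (\<lambda>V. V \<in> \<B>)"
      unfolding \<B>_def intersection_of_def by (auto simp: fun_eq_iff image_iff)
    moreover have "openin (topology_generated_by \<G>) = generate_topology_on \<G>"
      by (rule ext) (rule openin_topology_generated_by_iff)
    ultimately show ?thesis by (metis generate_topology_on_eq)
  qed
  ultimately show ?thesis unfolding second_countable by blast
qed

text \<open>Continuity is tested on generators. The whole set \<open>A\<close> may be one of them,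
  so that the underlying set is right even for empty \<open>I\<close>.\<close>

lemma continuous_map_into_topology_generated_by:
  assumes \<G>: "\<G> \<subseteq> insert A (\<Union>i\<in>I. Collect (openin (S i)))" "\<Union>\<G> = A"
    and f: "f ` topspace X \<subseteq> A" "\<And>i. i \<in> I \<Longrightarrow> continuous_map X (S i) f"
  shows "continuous_map X (topology_generated_by \<G>) f"
proof (rule continuous_on_generated_topo)
  show "f ` topspace X \<subseteq> \<Union>\<G>" using f(1) \<G>(2) by simp
  fix U assume "U \<in> \<G>"
  then consider "U = A" | i where "i \<in> I" "openin (S i) U" using \<G>(1) by auto
  then show "openin X (f -` U \<inter> topspace X)"
  proof cases
    case 1
    then have "f -` U \<inter> topspace X = topspace X" using f(1) by auto
    then show ?thesis by simp
  next
    case 2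
    then show ?thesis using f(2) unfolding continuous_map_alt by blast
  qed
qed

lemma second_countable_pullback_topology:
  assumes "second_countable X"
  shows "second_countable (pullback_topology A f X)"
proof -
  obtain \<B> where \<B>: "countable \<B>" "\<And>V. V \<in> \<B> \<Longrightarrow> openin X V"
    "\<And>U x. openin X U \<Longrightarrow> x \<in> U \<Longrightarrow> \<exists>V \<in> \<B>. x \<in> V \<and> V \<subseteq> U"
    using assms unfolding second_countable_def by metis
  show ?thesis
    unfolding second_countable_def
  proof (intro exI conjI allI impI)
    show "countable ((\<lambda>V. f -` V \<inter> A) ` \<B>)" using \<B>(1) by simp
    show "\<forall>V\<in>(\<lambda>V. f -` V \<inter> A) ` \<B>. openin (pullback_topology A f X) V"
      using \<B>(2) by (auto simp: openin_pullback_topology)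
    fix U x assume "openin (pullback_topology A f X) U \<and> x \<in> U"
    then obtain U' where "openin X U'" "U = f -` U' \<inter> A" "x \<in> U"
      by (auto simp: openin_pullback_topology)
    moreover from this obtain V where "V \<in> \<B>" "f x \<in> V" "V \<subseteq> U'"
      using \<B>(3)[of U' "f x"] by auto
    ultimately show "\<exists>V\<in>(\<lambda>V. f -` V \<inter> A) ` \<B>. x \<in> V \<and> V \<subseteq> U"
      by (intro bexI[of _ "f -` V \<inter> A"]) auto
  qed
qed

section \<open>Functions from scales of sets\<close>

text \<open>Dyadics straddling \<open>x\<close> at distance less than \<open>y - x\<close> exist,
  and the upper one cannot reach \<open>y\<close>.\<close>

lemma dyadic_between:
  fixes x y :: real
  assumes "0 \<le> x" "x < y"
  obtains r where "r \<in> dyadics" "x < r" "r < y"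
proof -
  have "0 < y - x" "(1::real) < 2" using assms by auto
  from padic_rational_approximation_straddle_pos_le[OF this assms(1)]
  obtain n q r where "of_nat q / 2^n \<le> x" "x < of_nat r / 2^n"
    "\<bar>real q / 2^n - real r / 2^n\<bar> < y - x" by metis
  then show ?thesis using that[of "of_nat r / 2^n"] by (auto simp: dyadics_def)
qed

text \<open>Urysohn's construction: a point goes to the infimum of the indices whose set contains
  it. Strict sublevel sets are unions of interiors, weak ones are intersections of the closed sets
  \<open>F s\<close>.\<close>

lemma continuous_map_from_scale:
  fixes F :: "real \<Rightarrow> 'a set"
  assumes clo: "\<And>r. r \<in> dyadics \<inter> {0..1} \<Longrightarrow> closedin X (F r)"
    and int: "\<And>r s. r \<in> dyadics \<inter> {0..1} \<Longrightarrow> s \<in> dyadics \<inter> {0..1} \<Longrightarrow> r < s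
                \<Longrightarrow> F r \<subseteq> X interior_of F s"
  obtains f where "continuous_map X euclideanreal f" "\<And>x. x \<in> F 0 \<Longrightarrow> f x = 0"
    "\<And>x. x \<notin> F 1 \<Longrightarrow> f x = 1"
proof
  \<comment> \<open>The inserted 1 keeps the set nonempty and bounds \<open>f\<close> by 1; points
    in no \<open>F r\<close> get the value 1.\<close>
  define f where "f x = Inf (insert 1 {r \<in> dyadics \<inter> {0..1}. x \<in> F r})" for x
  have bdd: "bdd_below (insert 1 {r \<in> dyadics \<inter> {0..1}. x \<in> F r})" for x
    by (auto simp: bdd_below_def intro!: exI[of _ 0])
  have zero: "0 \<in> dyadics \<inter> {0..1::real}" and one: "1 \<in> dyadics \<inter> {0..1::real}"
    using real_in_dyadics[of 0] real_in_dyadics[of 1] by auto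
  have mono: "F r \<subseteq> F s" if "r \<in> dyadics \<inter> {0..1}" "s \<in> dyadics \<inter> {0..1}" "r \<le> s" for r s
    using int[OF that(1,2)] that(3) interior_of_subset by (cases "r = s") force+
  have f_nonneg: "0 \<le> f x" for x
    unfolding f_def by (rule cInf_greatest) auto
  have f_le1: "f x \<le> 1" for x
    unfolding f_def by (rule cInf_lower[OF _ bdd]) auto
  have f_le: "f x \<le> r" if "r \<in> dyadics \<inter> {0..1}" "x \<in> F r" for r x
    unfolding f_def by (rule cInf_lower[OF _ bdd]) (use that in auto)
  \<comment> \<open>The bound \<open>a \<le> 1\<close> rules out the inserted 1 as the
    witness.\<close>
  have f_less: "f x < a \<longleftrightarrow> (\<exists>r \<in> dyadics \<inter> {0..1}. r < a \<and> x \<in> F r)" if "a \<le> 1" for x a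
    unfolding f_def cInf_less_iff[OF insert_not_empty bdd] using that by auto
  have *: "\<exists>s \<in> dyadics \<inter> {0..1}. r < s \<and> s < a" if "0 \<le> r" "r < a" "a \<le> 1" for r a :: real
    using dyadic_between[OF that(1,2)] that by (metis IntI atLeastAtMost_iff less_imp_le order_trans)
  show "continuous_map X euclideanreal f"
    unfolding continuous_map_upper_lower_semicontinuous_lte
  proof (intro conjI allI)
    fix a
    show "openin X {x \<in> topspace X. f x < a}"
    proof (cases "a \<le> 1")
      case True
      have "{x \<in> topspace X. f x < a}
          = (\<Union>s \<in> {s \<in> dyadics \<inter> {0..1}. s < a}. X interior_of F s)" (is "?L = ?R")
      proof (intro equalityI subsetI)
        fix x assume "x \<in> ?L"
        then obtain r where r: "r \<in> dyadics \<inter> {0..1}" "r < a" "x \<in> F r"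
          using f_less[OF True] by auto
        then obtain s where "s \<in> dyadics \<inter> {0..1}" "r < s" "s < a"
          using *[of r a] True by auto
        then show "x \<in> ?R" using int[OF r(1)] r(3) by blast
      next
        fix x assume "x \<in> ?R"
        then show "x \<in> ?L"
          using f_less[OF True] interior_of_subset interior_of_subset_topspace by fastforce
      qed
      then show ?thesis by auto
    next
      case False
      then have "{x \<in> topspace X. f x < a} = topspace X" using f_le1 by (smt (verit) Collect_cong Collect_mem_eq)
      then show ?thesis by simp
    qed
    show "closedin X {x \<in> topspace X. f x \<le> a}"
    proof (cases "0 \<le> a \<and> a < 1")
      case True
      have "{x \<in> topspace X. f x \<le> a} = (\<Inter>s \<in> {s \<in> dyadics \<inter> {0..1}. a < s}. F s)" (is "?L = ?R")
      proof (intro equalityI subsetI)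
        fix x assume x: "x \<in> ?L"
        show "x \<in> ?R"
        proof
          fix s assume s: "s \<in> {s \<in> dyadics \<inter> {0..1}. a < s}"
          then have "f x < s" "s \<le> 1" using x by auto
          then obtain r where "r \<in> dyadics \<inter> {0..1}" "r < s" "x \<in> F r"
            using f_less by blast
          then show "x \<in> F s" using mono[of r s] s by auto
        qed
      next
        fix x assume x: "x \<in> ?R"
        have "f x \<le> a"
        proof (rule ccontr)
          assume "\<not> f x \<le> a"
          then obtain s where "s \<in> dyadics \<inter> {0..1}" "a < s" "s < f x"
            using *[of a "f x"] f_le1[of x] True by auto
          then show False using x f_le[of s x] by auto
        qed
        moreover have "x \<in> F 1" using x one True by auto
        then have "x \<in> topspace X" using clo[OF one] closedin_subset by blast
        ultimately show "x \<in> ?L" by simp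
      qed
      moreover have "closedin X ?R"
        by (rule closedin_Inter) (use one True clo in auto)
      ultimately show ?thesis by simp
    next
      case False
      then have "{x \<in> topspace X. f x \<le> a} = topspace X \<or> {x \<in> topspace X. f x \<le> a} = {}"
        using f_le1 f_nonneg by (smt (verit) Collect_empty_eq Collect_cong Collect_mem_eq)
      then show ?thesis by (metis closedin_empty closedin_topspace)
    qed
  qed
  show "f x = 0" if "x \<in> F 0" for x
    using f_le[OF zero that] f_nonneg[of x] by simp
  show "f x = 1" if "x \<notin> F 1" for x
  proof (rule ccontr)
    assume "f x \<noteq> 1"
    then have "f x < 1" using f_le1[of x] by simp
    then obtain r where "r \<in> dyadics \<inter> {0..1}" "x \<in> F r"
      using f_less[of 1 x] by blast
    then show False using mono[OF _ one, of r] that by auto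
  qed
qed

section \<open>Paratopological groups\<close>

context paratopological_group
begin

lemma continuous_map_mult:
  assumes "continuous_map X T f" "continuous_map X T g"
  shows "continuous_map X T (\<lambda>x. f x \<otimes> g x)"
  using continuous_map_compose[OF continuous_map_pairedI[OF assms] continuous_mult]
  by (simp add: o_def)

lemma continuous_map_lmult:
  assumes "a \<in> carrier G"
  shows "continuous_map T T (\<lambda>x. a \<otimes> x)"
  by (rule continuous_map_mult) (use assms topspace_eq_carrier in auto)

lemma continuous_map_rmult:
  assumes "a \<in> carrier G"
  shows "continuous_map T T (\<lambda>x. x \<otimes> a)"
  by (rule continuous_map_mult) (use assms topspace_eq_carrier in auto)

text \<open>The set is the translate \<open>a W\<close>, the preimage of \<open>W\<close> under left
  multiplication by the fixed element \<open>inv a\<close>.\<close>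

lemma openin_translate:
  assumes "openin T W" "a \<in> carrier G"
  shows "openin T {x \<in> carrier G. inv a \<otimes> x \<in> W}"
  using openin_continuous_map_preimage[OF continuous_map_lmult[of "inv a"] assms(1)] assms(2)
  by (simp add: topspace_eq_carrier)

text \<open>Continuity at \<open>(\<one>, \<one>)\<close> gives a box mapped into \<open>W\<close>;
  intersect its two sides. This supplies the interpolation step of the dyadic recursion.\<close>

lemma square_root_neighbourhood:
  assumes "openin T W" "\<one> \<in> W"
  obtains V where "openin T V" "\<one> \<in> V" "\<And>x y. x \<in> V \<Longrightarrow> y \<in> V \<Longrightarrow> x \<otimes> y \<in> W"
proof -
  have "openin (prod_topology T T) {z \<in> topspace (prod_topology T T). (\<lambda>(x, y). x \<otimes> y) z \<in> W}"
    by (rule openin_continuous_map_preimage[OF continuous_mult assms(1)])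
  moreover have "(\<one>, \<one>) \<in> {z \<in> topspace (prod_topology T T). (\<lambda>(x, y). x \<otimes> y) z \<in> W}"
    using assms(2) by (simp add: topspace_eq_carrier)
  ultimately have "\<exists>U V. openin T U \<and> openin T V \<and> \<one> \<in> U \<and> \<one> \<in> V \<and>
      U \<times> V \<subseteq> {z \<in> topspace (prod_topology T T). (\<lambda>(x, y). x \<otimes> y) z \<in> W}"
    unfolding openin_prod_topology_alt by blast
  then obtain U V where "openin T U" "openin T V" "\<one> \<in> U" "\<one> \<in> V"
    "U \<times> V \<subseteq> {z \<in> topspace (prod_topology T T). (\<lambda>(x, y). x \<otimes> y) z \<in> W}"
    by blast
  moreover from this have "x \<otimes> y \<in> W" if "x \<in> U \<inter> V" "y \<in> U \<inter> V" for x y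
    using that by auto
  ultimately show ?thesis using that[of "U \<inter> V"] by auto
qed

text \<open>The set \<open>cl(A) W\<close> is open, being a union of left translates of \<open>W\<close>, and it is contained in
  \<open>cl(A W)\<close>, since right translations are continuous. This replaces the inclusion
  \<open>cl(A) \<subseteq> A W\<inverse>\<close> available in topological groups.\<close>

lemma closure_of_subset_interior_of_closure_of:
  assumes A: "A \<subseteq> carrier G" and W: "openin T W" "\<one> \<in> W"
    and AW: "\<And>a w. a \<in> A \<Longrightarrow> w \<in> W \<Longrightarrow> a \<otimes> w \<in> B"
  shows "T closure_of A \<subseteq> T interior_of (T closure_of B)"
proof -
  define V where "V = (\<Union>a \<in> T closure_of A. {x \<in> carrier G. inv a \<otimes> x \<in> W})"
  have cl: "T closure_of A \<subseteq> carrier G"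
    using closure_of_subset_topspace[of T A] by (simp add: topspace_eq_carrier)
  have Wc: "W \<subseteq> carrier G" using openin_subset[OF W(1)] by (simp add: topspace_eq_carrier)
  have "openin T V"
    unfolding V_def by (intro openin_Union) (use openin_translate W(1) cl in blast)
  moreover have "V \<subseteq> T closure_of B"
  proof
    fix x assume "x \<in> V"
    then obtain a where a: "a \<in> T closure_of A" and x: "x \<in> carrier G" "inv a \<otimes> x \<in> W"
      unfolding V_def by auto
    let ?w = "inv a \<otimes> x"
    have "?w \<in> carrier G" using x(2) Wc by auto
    then have "(\<lambda>y. y \<otimes> ?w) ` (T closure_of A) \<subseteq> T closure_of ((\<lambda>y. y \<otimes> ?w) ` A)"
      by (intro continuous_map_image_closure_subset continuous_map_rmult)
    also have "\<dots> \<subseteq> T closure_of B"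
      by (rule closure_of_mono) (use AW x(2) in auto)
    finally have "a \<otimes> ?w \<in> T closure_of B" using a by auto
    moreover have "a \<otimes> ?w = x" using a cl x(1) inv_solve_left' by (auto simp: m_assoc[symmetric])
    ultimately show "x \<in> T closure_of B" by simp
  qed
  moreover have "T closure_of A \<subseteq> V"
    unfolding V_def using cl W(2) by force
  ultimately show ?thesis using interior_of_maximal by (metis subset_trans)
qed

text \<open>The dyadic scale interpolates the relation \<open>A W \<subseteq> B\<close> for some identity neighbourhood \<open>W\<close>; its
  closures then form a scale as in the Urysohn lemma. Only \<open>cl(U)\<close>, not \<open>U\<close>, is reached without
  regularity.\<close>

lemma Urysohn_function_at_one:
  assumes U: "openin T U" "\<one> \<in> U"
  obtains f where "continuous_map T euclideanreal f" "f \<one> = 0"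
    "\<And>x. x \<notin> T closure_of U \<Longrightarrow> f x = 1"
proof -
  define R where "R A B \<longleftrightarrow> A \<subseteq> carrier G \<and>
      (\<exists>W. openin T W \<and> \<one> \<in> W \<and> (\<forall>a\<in>A. \<forall>w\<in>W. a \<otimes> w \<in> B))" for A B
  have sub: "V \<subseteq> carrier G" if "openin T V" for V
    using openin_subset[OF that] by (simp add: topspace_eq_carrier)
  \<comment> \<open>The recursion requires that \<open>R\<close> relate the two ends, admit
    interpolation and be transitive; these are the three goals.\<close>
  have "\<exists>F :: real \<Rightarrow> 'a set. F 0 = {\<one>} \<and> F 1 = U \<and>
      (\<forall>x \<in> dyadics \<inter> {0..1}. \<forall>y \<in> dyadics \<inter> {0..1}. x < y \<longrightarrow> R (F x) (F y))"
  proof (rule recursion_on_dyadic_fractions)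
    show "R {\<one>} U" unfolding R_def
    proof (intro conjI exI[of _ U])
      show "\<forall>a\<in>{\<one>}. \<forall>w\<in>U. a \<otimes> w \<in> U" using sub[OF U(1)] by auto
    qed (use U in auto)
  next
    fix A B assume "R A B"
    then obtain W where A: "A \<subseteq> carrier G" and W: "openin T W" "\<one> \<in> W"
      and AW: "\<And>a w. a \<in> A \<Longrightarrow> w \<in> W \<Longrightarrow> a \<otimes> w \<in> B" unfolding R_def by auto
    obtain V where V: "openin T V" "\<one> \<in> V" "\<And>x y. x \<in> V \<Longrightarrow> y \<in> V \<Longrightarrow> x \<otimes> y \<in> W"
      using square_root_neighbourhood[OF W] by metis
    \<comment> \<open>As \<open>V V\<close> lies in \<open>W\<close>, the product \<open>A V\<close>
      sits between \<open>A\<close> and \<open>B\<close>, with \<open>V\<close> witnessing both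
      relations.\<close>
    let ?C = "{a \<otimes> v | a v. a \<in> A \<and> v \<in> V}"
    have "R A ?C" unfolding R_def using A V(1,2) by auto
    moreover have "R ?C B"
      unfolding R_def
    proof (intro conjI exI[of _ V] ballI)
      show "?C \<subseteq> carrier G" using A sub[OF V(1)] by auto
      fix c w assume "c \<in> ?C" and w: "w \<in> V"
      then obtain a v where c: "c = a \<otimes> v" "a \<in> A" "v \<in> V" by auto
      then have "c \<otimes> w = a \<otimes> (v \<otimes> w)" using w A sub[OF V(1)] by (auto simp: m_assoc subset_iff)
      then show "c \<otimes> w \<in> B" using AW V(3) c w by simp
    qed (use V in auto)
    ultimately show "\<exists>C. R A C \<and> R C B" by blast
  next
    fix A B C assume AB: "R A B" and BC: "R B C"
    then obtain W where W: "openin T W" "\<one> \<in> W" "\<And>b w. b \<in> B \<Longrightarrow> w \<in> W \<Longrightarrow> b \<otimes> w \<in> C"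
      unfolding R_def by auto
    \<comment> \<open>A neighbourhood of \<open>\<one>\<close> contains \<open>\<one>\<close>, so
      \<open>A \<subseteq> B\<close> and the witness for \<open>R B C\<close> serves for
      \<open>R A C\<close>.\<close>
    have "a \<in> B" if "a \<in> A" for a
      using AB that unfolding R_def by (metis r_one subsetD)
    then show "R A C" using AB W unfolding R_def by blast
  qed
  then obtain F :: "real \<Rightarrow> 'a set" where F0: "F 0 = {\<one>}" and F1: "F 1 = U"
    and F: "\<And>x y. x \<in> dyadics \<inter> {0..1} \<Longrightarrow> y \<in> dyadics \<inter> {0..1} \<Longrightarrow> x < y \<Longrightarrow> R (F x) (F y)"
    by metis
  have "T closure_of F r \<subseteq> T interior_of (T closure_of F s)"
    if "r \<in> dyadics \<inter> {0..1}" "s \<in> dyadics \<inter> {0..1}" "r < s" for r s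
    using F[OF that] closure_of_subset_interior_of_closure_of unfolding R_def by metis
  then obtain f where f: "continuous_map T euclideanreal f" "\<And>x. x \<in> T closure_of F 0 \<Longrightarrow> f x = 0"
    "\<And>x. x \<notin> T closure_of F 1 \<Longrightarrow> f x = 1"
    using continuous_map_from_scale[of T "\<lambda>r. T closure_of F r"] by (metis closedin_closure_of)
  have "\<one> \<in> T closure_of F 0"
    using closure_of_subset[of "{\<one>}" T] by (simp add: F0 topspace_eq_carrier)
  then show ?thesis using that f F1 by metis
qed

text \<open>Regularity shrinks \<open>U\<close> to some \<open>V\<close> with closure inside
  \<open>U\<close>; the function built for \<open>V\<close> then separates \<open>\<one>\<close>
  from the complement of \<open>U\<close>.\<close>

lemma regular_Urysohn_function_at_one:
  assumes "regular_space T" "openin T U" "\<one> \<in> U"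
  obtains f where "continuous_map T euclideanreal f" "f \<one> = 0"
    "\<And>x. x \<in> carrier G - U \<Longrightarrow> f x = 1"
proof -
  have "closedin T (carrier G - U)" "\<one> \<in> topspace T - (carrier G - U)"
    using assms(2,3) by (auto simp: topspace_eq_carrier[symmetric]) (auto simp: topspace_eq_carrier)
  then obtain V where V: "openin T V" "\<one> \<in> V" "disjnt (carrier G - U) (T closure_of V)"
    using assms(1) unfolding regular_space by metis
  obtain f where "continuous_map T euclideanreal f" "f \<one> = 0"
    "\<And>x. x \<notin> T closure_of V \<Longrightarrow> f x = 1"
    using Urysohn_function_at_one[OF V(1,2)] by metis
  then show ?thesis using that[of f] V(3) by (auto simp: disjnt_iff)
qed

section \<open>Subgroups and coarser second-countable group topologies\<close>

lemma paratopological_group_subgroup: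
  assumes "subgroup H G"
  shows "paratopological_group (G\<lparr>carrier := H\<rparr>) (subtopology T H)"
proof -
  have H: "H \<subseteq> carrier G" using assms subgroup.subset by blast
  have "group (G\<lparr>carrier := H\<rparr>)" using assms subgroup_imp_group by blast
  moreover have "topspace (subtopology T H) = H" using H topspace_eq_carrier by auto
  moreover have "continuous_map (prod_topology (subtopology T H) (subtopology T H)) (subtopology T H)
      (\<lambda>(x, y). x \<otimes> y)"
    unfolding subtopology_Times[symmetric]
    by (intro continuous_map_into_subtopology continuous_map_from_subtopology continuous_mult)
      (auto simp: subgroup.m_closed[OF assms])
  ultimately show ?thesis
    by (simp add: paratopological_group_def paratopological_group_axioms_def)
qed

text \<open>Since no separation axiom is imposed on the quotients, the topology of a second-countable
  quotient of \<open>G\<close> may be pulled back to \<open>G\<close>.\<close>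

lemma R_factorizable_iff_coarser_topology:
  "R_factorizable G T \<longleftrightarrow>
     (\<forall>\<phi>. continuous_map T euclideanreal \<phi> \<longrightarrow>
       (\<exists>S. paratopological_group G S \<and> second_countable S \<and> continuous_map T S id \<and>
            continuous_map S euclideanreal \<phi>))" (is "?L \<longleftrightarrow> ?R")
proof
  assume ?L
  show ?R
  proof (intro allI impI)
    fix \<phi> assume "continuous_map T euclideanreal \<phi>"
    then obtain K :: "'a monoid" and TK where K: "paratopological_group K TK" "second_countable TK"
      and "factors_through G T K TK \<phi>"
      using \<open>?L\<close> unfolding R_factorizable_def by blast
    then obtain \<pi> h where hom: "\<pi> \<in> hom G K" and cpi: "continuous_map T TK \<pi>"
      and ch: "continuous_map TK euclideanreal h" and eq: "\<And>x. x \<in> carrier G \<Longrightarrow> \<phi> x = h (\<pi> x)"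
      by (auto simp: factors_through_def epi_def)
    interpret K: paratopological_group K TK by (rule K)
    define S where "S = pullback_topology (carrier G) \<pi> TK"
    have top: "topspace S = carrier G"
      using hom by (auto simp: S_def topspace_pullback_topology K.topspace_eq_carrier hom_def)
    have c\<pi>: "continuous_map S TK \<pi>"
      using continuous_map_pullback[OF continuous_map_id[of TK], of "carrier G" \<pi>]
      by (simp add: S_def)
    have "continuous_map (prod_topology S S) S (\<lambda>(x, y). x \<otimes> y)"
      unfolding S_def
    proof (rule continuous_map_pullback')
      \<comment> \<open>Continuity into the pullback is checked after composing with
        \<open>\<pi>\<close>, which turns the product in \<open>G\<close> into one in
        \<open>K\<close>.\<close>
      have "continuous_map (prod_topology S S) TK (\<lambda>z. \<pi> (fst z) \<otimes>\<^bsub>K\<^esub> \<pi> (snd z))"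
        by (intro K.continuous_map_mult continuous_map_compose[OF continuous_map_fst c\<pi>, unfolded o_def]
            continuous_map_compose[OF continuous_map_snd c\<pi>, unfolded o_def])
      then show "continuous_map (prod_topology (pullback_topology (carrier G) \<pi> TK)
          (pullback_topology (carrier G) \<pi> TK)) TK (\<pi> \<circ> (\<lambda>(x, y). x \<otimes> y))"
        unfolding S_def[symmetric]
        by (rule continuous_map_eq) (auto simp: top hom_mult[OF hom])
      show "topspace (prod_topology (pullback_topology (carrier G) \<pi> TK)
          (pullback_topology (carrier G) \<pi> TK)) \<subseteq> (\<lambda>(x, y). x \<otimes> y) -` carrier G"
        unfolding S_def[symmetric] by (auto simp: top)
    qed
    then have "paratopological_group G S"
      using top is_group by (simp add: paratopological_group_def paratopological_group_axioms_def)
    moreover have "second_countable S"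
      unfolding S_def by (rule second_countable_pullback_topology[OF K(2)])
    moreover have "continuous_map T S id"
      unfolding S_def
      by (rule continuous_map_pullback') (use cpi in \<open>auto simp: topspace_eq_carrier\<close>)
    moreover have "continuous_map S euclideanreal \<phi>"
      by (rule continuous_map_eq[OF continuous_map_compose[OF c\<pi> ch]]) (simp add: top eq)
    ultimately show "\<exists>S. paratopological_group G S \<and> second_countable S \<and> continuous_map T S id \<and>
        continuous_map S euclideanreal \<phi>" by blast
  qed
next
  assume ?R
  show ?L
    unfolding R_factorizable_def
  proof (intro allI impI)
    fix \<phi> assume "continuous_map T euclideanreal \<phi>"
    then obtain S where S: "paratopological_group G S" "second_countable S"
      and "continuous_map T S id" "continuous_map S euclideanreal \<phi>"
      using \<open>?R\<close> by blast
    \<comment> \<open>The quotient is \<open>G\<close> itself with topology \<open>S\<close>.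
      Transport follows because \<open>G\<close> may be an extended record, while \<open>K\<close>
      must be a plain monoid.\<close>
    then have "factors_through G T G S \<phi>"
      unfolding factors_through_def by (intro exI[of _ id] exI[of _ \<phi>]) (auto simp: epi_def hom_def)
    then show "\<exists>(K :: 'a monoid) TK. paratopological_group K TK \<and> second_countable TK \<and>
        factors_through G T K TK \<phi>"
      by (rule factors_through_transport[OF topspace_eq_carrier S])
  qed
qed

text \<open>The union of the countable bases generates the supremum. Multiplication is continuous
  into each \<open>S i\<close>, hence into the supremum. Continuity of \<open>id\<close> expresses
  that the target topology is coarser.\<close>

lemma supremum_of_second_countable_topologies:
  assumes I: "countable I"
    and S: "\<And>i. i \<in> I \<Longrightarrow> paratopological_group G (S i)"
      "\<And>i. i \<in> I \<Longrightarrow> second_countable (S i)" "\<And>i. i \<in> I \<Longrightarrow> continuous_map T (S i) id"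
  obtains S' where "paratopological_group G S'" "second_countable S'" "continuous_map T S' id"
    "\<And>i. i \<in> I \<Longrightarrow> continuous_map S' (S i) id"
proof -
  have "\<exists>\<B>. countable \<B> \<and> openin (S i) = arbitrary union_of (\<lambda>V. V \<in> \<B>)" if "i \<in> I" for i
    using S(2)[OF that] unfolding second_countable .
  then obtain \<B> where \<B>: "\<And>i. i \<in> I \<Longrightarrow> countable (\<B> i)"
    "\<And>i. i \<in> I \<Longrightarrow> openin (S i) = arbitrary union_of (\<lambda>V. V \<in> \<B> i)"
    by metis
  have opB: "openin (S i) V" if "i \<in> I" "V \<in> \<B> i" for i V
    using \<B>(2)[OF that(1)] that(2) by (simp add: arbitrary_union_of_inc)
  have topS: "topspace (S i) = carrier G" if "i \<in> I" for i
    using S(1)[OF that] paratopological_group.topspace_eq_carrier by blast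
  define \<G> where "\<G> = insert (carrier G) (\<Union>i\<in>I. \<B> i)"
  define S' where "S' = topology_generated_by \<G>"
  have \<G>_sub: "\<Union>\<G> = carrier G"
    unfolding \<G>_def using opB topS openin_subset by fastforce
  then have top: "topspace S' = carrier G" by (simp add: S'_def)
  have S'S: "continuous_map S' (S i) id" if i: "i \<in> I" for i
  proof -
    have "openin S' U" if U: "openin (S i) U" for U
    proof -
      obtain \<U> where "\<U> \<subseteq> \<B> i" "U = \<Union>\<U>"
        using U unfolding \<B>(2)[OF i] union_of_def arbitrary_def by auto
      moreover have "openin S' V" if "V \<in> \<B> i" for V
        using that i unfolding S'_def \<G>_def by (intro topology_generated_by_Basis) auto
      ultimately show ?thesis by (simp add: openin_Union subset_iff)
    qed
    then show ?thesis
      by (auto simp: continuous_map_def top topS[OF i])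
        (metis (no_types, lifting) Collect_mem_eq Collect_cong inf.absorb_iff2 Int_def openin_subset topS[OF i])
  qed
  have \<G>_open: "\<G> \<subseteq> insert (carrier G) (\<Union>i\<in>I. Collect (openin (S i)))"
    unfolding \<G>_def using opB by auto
  note into = continuous_map_into_topology_generated_by[OF \<G>_open \<G>_sub, folded S'_def]
  have "continuous_map (prod_topology S' S') S' (\<lambda>(x, y). x \<otimes> y)"
  proof (rule into)
    fix i assume i: "i \<in> I"
    interpret Si: paratopological_group G "S i" by (rule S(1)[OF i])
    have "continuous_map (prod_topology S' S') (S i) (\<lambda>z. fst z \<otimes> snd z)"
      using continuous_map_compose[OF continuous_map_fst S'S[OF i]]
        continuous_map_compose[OF continuous_map_snd S'S[OF i]]
      by (intro Si.continuous_map_mult) auto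
    then show "continuous_map (prod_topology S' S') (S i) (\<lambda>(x, y). x \<otimes> y)"
      by (simp add: case_prod_unfold)
  qed (auto simp: top)
  then have "paratopological_group G S'"
    using top is_group by (simp add: paratopological_group_def paratopological_group_axioms_def)
  moreover have "second_countable S'"
    unfolding S'_def \<G>_def
    by (intro second_countable_topology_generated_by) (use I \<B>(1) in auto)
  moreover have "continuous_map T S' id"
    by (rule into) (auto simp: topspace_eq_carrier S(3))
  ultimately show ?thesis using that S'S by metis
qed

end

section \<open>Factorizability and \<open>z\<close>-embedding of subgroups\<close>

lemma continuous_map_coarser:
  assumes "continuous_map T S id" "continuous_map S X f"
  shows "continuous_map T X f"
  using continuous_map_compose[OF assms] by simp

text \<open>If \<open>f\<close> is continuous on \<open>H\<close>, the sets where \<open>f > q\<close> and \<open>f < q\<close> for rational \<open>q\<close> are traces of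
  cozero sets of \<open>G\<close>, and the countably many functions defining these are simultaneously
  continuous for one second-countable coarser topology.\<close>

lemma (in paratopological_group) R_factorizable_subgroup_if_z_embedded:
  assumes R: "R_factorizable G T" and H: "subgroup H G" and z: "z_embedded_in T H"
  shows "R_factorizable (G\<lparr>carrier := H\<rparr>) (subtopology T H)"
proof -
  interpret H: paratopological_group "G\<lparr>carrier := H\<rparr>" "subtopology T H"
    by (rule paratopological_group_subgroup[OF H])
  have Hsub: "H \<subseteq> carrier G" using H subgroup.subset by blast
  then have topH: "topspace (subtopology T H) = H" by (auto simp: topspace_eq_carrier)
  show ?thesis
    unfolding H.R_factorizable_iff_coarser_topology
  proof (intro allI impI)
    fix f assume f: "continuous_map (subtopology T H) euclideanreal f"
    \<comment> \<open>The complements in \<open>H\<close> of these sets are the sets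
      \<open>f > q\<close> and \<open>f < q\<close>.\<close>
    define Z where "Z = (\<lambda>(q, b). if b then {x \<in> H. f x \<le> q} else {x \<in> H. f x \<ge> q})"
    have zero_Z: "zero_set_in (subtopology T H) (Z p)" for p
      using zero_set_in_le[OF f, unfolded topH] zero_set_in_ge[OF f, unfolded topH]
      by (simp add: Z_def split: prod.split)
    have "\<exists>g. continuous_map T euclideanreal g \<and> Z p = {x \<in> H. g x = 0}" for p
    proof -
      obtain C where "zero_set_in T C" "Z p = C \<inter> H"
        using z[unfolded z_embedded_in_def, THEN conjunct2, rule_format, OF zero_Z] by metis
      then obtain g where "continuous_map T euclideanreal g" "C = {x \<in> topspace T. g x = 0}"
        unfolding zero_set_in_def by blast
      then show ?thesis
        using \<open>Z p = C \<inter> H\<close> Hsub by (intro exI[of _ g]) (auto simp: topspace_eq_carrier)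
    qed
    then obtain g where g: "\<And>p. continuous_map T euclideanreal (g p)"
      and Z: "\<And>p. Z p = {x \<in> H. g p x = 0}" by metis
    have "\<exists>S. paratopological_group G S \<and> second_countable S \<and> continuous_map T S id \<and>
            continuous_map S euclideanreal (g p)" for p
      using R g unfolding R_factorizable_iff_coarser_topology by blast
    then obtain S where S: "\<And>p. paratopological_group G (S p)" "\<And>p. second_countable (S p)"
      "\<And>p. continuous_map T (S p) id" "\<And>p. continuous_map (S p) euclideanreal (g p)" by metis
    define I where "I = (\<rat> :: real set) \<times> (UNIV :: bool set)"
    have I: "countable I" unfolding I_def by (intro countable_SIGMA countable_rat) auto
    obtain S' where S': "paratopological_group G S'" "second_countable S'" "continuous_map T S' id"
      and S'S: "\<And>p. p \<in> I \<Longrightarrow> continuous_map S' (S p) id"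
      using supremum_of_second_countable_topologies[of I S, OF I S(1-3)] by metis
    interpret S': paratopological_group G S' by (rule S'(1))
    have cg: "continuous_map S' euclideanreal (g p)" if "p \<in> I" for p
      using continuous_map_coarser[OF S'S[OF that] S(4)] .
    have op: "openin (subtopology S' H) (H - Z p)" if "p \<in> I" for p
    proof -
      have "openin S' {x \<in> topspace S'. g p x \<in> - {0}}"
        by (rule openin_continuous_map_preimage[OF cg[OF that]]) (simp add: open_Compl)
      moreover have "H - Z p = H \<inter> {x \<in> topspace S'. g p x \<in> - {0}}"
        using Hsub by (auto simp: Z S'.topspace_eq_carrier)
      ultimately show ?thesis by (metis openin_subtopology_Int2)
    qed
    have topH': "topspace (subtopology S' H) = H" using Hsub by (auto simp: S'.topspace_eq_carrier)
    have less_iff: "x < y \<longleftrightarrow> (\<exists>q \<in> \<rat>. x < q \<and> q < y)" for x y :: real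
      using Rats_dense_in_real[of x y] by auto
    have "continuous_map (subtopology S' H) euclideanreal f"
      unfolding continuous_map_upper_lower_semicontinuous_lt topH'
    proof (intro conjI allI)
      fix a
      have "{x \<in> H. f x > a} = (\<Union>q \<in> {q \<in> \<rat>. a < q}. H - Z (q, True))"
        unfolding less_iff[of a "f _"] by (simp add: Z_def set_eq_iff) (metis not_le)
      moreover have "openin (subtopology S' H) \<dots>"
        using op by (intro openin_Union) (auto simp: I_def)
      ultimately show "openin (subtopology S' H) {x \<in> H. f x > a}" by simp
      have "{x \<in> H. f x < a} = (\<Union>q \<in> {q \<in> \<rat>. q < a}. H - Z (q, False))"
        unfolding less_iff[of "f _" a] by (simp add: Z_def set_eq_iff) (metis not_le)
      moreover have "openin (subtopology S' H) \<dots>"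
        using op by (intro openin_Union) (auto simp: I_def)
      ultimately show "openin (subtopology S' H) {x \<in> H. f x < a}" by simp
    qed
    moreover have "continuous_map (subtopology T H) (subtopology S' H) id"
      using S'(3) by (intro continuous_map_into_subtopology continuous_map_from_subtopology) auto
    ultimately show "\<exists>S. paratopological_group (G\<lparr>carrier := H\<rparr>) S \<and> second_countable S \<and>
        continuous_map (subtopology T H) S id \<and> continuous_map S euclideanreal f"
      using S'.paratopological_group_subgroup[OF H] second_countable_subtopology[OF S'(2)] by blast
  qed
qed

text \<open>The complement \<open>D\<close> of \<open>Z\<close> in \<open>H\<close> is shown to be
  the trace of a union of cozero sets \<open>E V x\<close>. Countably many \<open>V\<close> suffice
  by second countability of \<open>S\<close>, and for each \<open>V\<close> countably many
  \<open>x\<close> by factorizability of \<open>G\<close>.\<close>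

lemma (in paratopological_group) z_embedded_if_R_factorizable_subgroup:
  assumes reg: "regular_space T" and R: "R_factorizable G T" and H: "subgroup H G"
    and RH: "R_factorizable (G\<lparr>carrier := H\<rparr>) (subtopology T H)"
  shows "z_embedded_in T H"
  unfolding z_embedded_in_def
proof (intro conjI allI impI)
  interpret H: paratopological_group "G\<lparr>carrier := H\<rparr>" "subtopology T H"
    by (rule paratopological_group_subgroup[OF H])
  have Hsub: "H \<subseteq> carrier G" using H subgroup.subset by blast
  then show "H \<subseteq> topspace T" by (simp add: topspace_eq_carrier)
  fix Z assume "zero_set_in (subtopology T H) Z"
  then obtain f where f: "continuous_map (subtopology T H) euclideanreal f" and Z: "Z = {x \<in> H. f x = 0}"
    unfolding zero_set_in_def using Hsub by (auto simp: topspace_eq_carrier subset_iff)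
  obtain S where "paratopological_group (G\<lparr>carrier := H\<rparr>) S" and sc: "second_countable S"
    and TS: "continuous_map (subtopology T H) S id" and fS: "continuous_map S euclideanreal f"
    using RH f unfolding H.R_factorizable_iff_coarser_topology by blast
  then interpret S: paratopological_group "G\<lparr>carrier := H\<rparr>" S by blast
  have topS: "topspace S = H" using S.topspace_eq_carrier by simp
  obtain \<B> where \<B>: "countable \<B>" "\<And>V. V \<in> \<B> \<Longrightarrow> openin S V"
    "\<And>U x. openin S U \<Longrightarrow> x \<in> U \<Longrightarrow> \<exists>V \<in> \<B>. x \<in> V \<and> V \<subseteq> U"
    using sc unfolding second_countable_def by metis
  \<comment> \<open>A countable base of identity neighbourhoods for \<open>S\<close>.\<close>
  define \<N> where "\<N> = {V \<in> \<B>. \<one> \<in> V}"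
  define D where "D = H - Z"
  have D: "openin S D"
    using openin_continuous_map_preimage[OF fS, of "- {0}"]
    by (simp add: topS D_def Z open_Compl set_diff_eq conj_commute cong: conj_cong)
  have "\<exists>\<phi>. continuous_map T euclideanreal \<phi> \<and> \<phi> \<one> = 0 \<and> (\<forall>x \<in> H. \<phi> x < 1 \<longrightarrow> x \<in> V)"
    if V: "V \<in> \<N>" for V
  proof -
    have "openin (subtopology T H) V"
    proof -
      have V': "openin S V" using V \<B>(2) by (simp add: \<N>_def)
      then have "V \<subseteq> H" using openin_subset topS by metis
      then have "{x \<in> topspace (subtopology T H). id x \<in> V} = V"
        using Hsub by (auto simp: topspace_eq_carrier)
      then show ?thesis using openin_continuous_map_preimage[OF TS V'] by metis
    qed
    then obtain U where U: "openin T U" "V = U \<inter> H" by (auto simp: openin_subtopology)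
    then have "\<one> \<in> U" using V by (auto simp: \<N>_def)
    with regular_Urysohn_function_at_one[OF reg U(1)] obtain \<phi>
      where "continuous_map T euclideanreal \<phi>" "\<phi> \<one> = 0" "\<And>x. x \<in> carrier G - U \<Longrightarrow> \<phi> x = 1"
      by metis
    then show ?thesis using U(2) Hsub by (intro exI[of _ \<phi>]) force
  qed
  then obtain \<phi> where \<phi>: "\<And>V. V \<in> \<N> \<Longrightarrow> continuous_map T euclideanreal (\<phi> V)"
    "\<And>V. V \<in> \<N> \<Longrightarrow> \<phi> V \<one> = 0" "\<And>V x. V \<in> \<N> \<Longrightarrow> x \<in> H \<Longrightarrow> \<phi> V x < 1 \<Longrightarrow> x \<in> V"
    by metis
  \<comment> \<open>\<open>E V x\<close> is a cozero neighbourhood of \<open>x\<close> in \<open>G\<close> whose trace on \<open>H\<close> lies in \<open>x V\<close>.\<close>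
  define E where "E V x = {y \<in> carrier G. \<phi> V (inv x \<otimes> y) < 1}" for V x
  \<comment> \<open>The centres \<open>x\<close> with \<open>x V \<subseteq> D\<close>, for which
    the trace of \<open>E V x\<close> on \<open>H\<close> stays inside \<open>D\<close>.\<close>
  define DV where "DV V = {x \<in> H. \<forall>v \<in> V. x \<otimes> v \<in> D}" for V
  \<comment> \<open>For fixed \<open>V\<close>, one group topology \<open>S'\<close> making
    \<open>\<phi> V\<close> continuous has all translates \<open>E V x\<close> open, so its Lindelof
    property applies. \<open>S'\<close> may vary with \<open>V\<close>.\<close>
  have "\<exists>C. countable C \<and> C \<subseteq> DV V \<and> (\<Union>x\<in>C. E V x) = (\<Union>x\<in>DV V. E V x)" if V: "V \<in> \<N>" for V
  proof -
    obtain S' where S': "paratopological_group G S'" "second_countable S'"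
      and \<phi>S': "continuous_map S' euclideanreal (\<phi> V)"
      using R \<phi>(1)[OF V] unfolding R_factorizable_iff_coarser_topology by blast
    interpret S': paratopological_group G S' by (rule S'(1))
    have "openin S' (E V x)" if "x \<in> DV V" for x
    proof -
      have "inv x \<in> carrier G" using that Hsub by (auto simp: DV_def)
      then have "continuous_map S' euclideanreal (\<lambda>y. \<phi> V (inv x \<otimes> y))"
        using continuous_map_compose[OF S'.continuous_map_lmult \<phi>S'] by (simp add: o_def)
      from openin_continuous_map_preimage[OF this, of "{..<1}"] show ?thesis
        by (simp add: E_def S'.topspace_eq_carrier)
    qed
    then show ?thesis by (rule second_countable_countable_subcover[OF S'(2)]) blast+
  qed
  then obtain C where C: "\<And>V. V \<in> \<N> \<Longrightarrow> countable (C V)" "\<And>V. V \<in> \<N> \<Longrightarrow> C V \<subseteq> DV V"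
    "\<And>V. V \<in> \<N> \<Longrightarrow> (\<Union>x\<in>C V. E V x) = (\<Union>x\<in>DV V. E V x)" by metis
  define \<Z> where "\<Z> = (\<Union>V\<in>\<N>. (\<lambda>x. carrier G - E V x) ` C V)"
  have "zero_set_in T (topspace T \<inter> \<Inter>\<Z>)"
  proof (rule zero_set_in_Inter)
    show "countable \<Z>"
      unfolding \<Z>_def using \<B>(1) C(1) by (intro countable_UN countable_image) (auto simp: \<N>_def)
    fix A assume "A \<in> \<Z>"
    then obtain V x where V: "V \<in> \<N>" and x: "x \<in> C V" and A: "A = carrier G - E V x"
      unfolding \<Z>_def by auto
    have "inv x \<in> carrier G" using x C(2)[OF V] Hsub by (auto simp: DV_def)
    then have "continuous_map T euclideanreal (\<lambda>y. \<phi> V (inv x \<otimes> y))"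
      using continuous_map_compose[OF continuous_map_lmult \<phi>(1)[OF V]] by (simp add: o_def)
    moreover have "A = {y \<in> topspace T. \<phi> V (inv x \<otimes> y) \<ge> 1}"
      by (auto simp: A E_def topspace_eq_carrier)
    ultimately show "zero_set_in T A" using zero_set_in_ge by metis
  qed
  moreover have "Z = (topspace T \<inter> \<Inter>\<Z>) \<inter> H"
  proof (intro equalityI subsetI)
    fix y assume y: "y \<in> Z"
    then have yH: "y \<in> H" by (simp add: Z)
    have "y \<notin> E V x" if V: "V \<in> \<N>" and x: "x \<in> C V" for V x
    proof
      assume yE: "y \<in> E V x"
      have xD: "x \<in> DV V" using C(2) V x by auto
      then have xH: "x \<in> H" by (simp add: DV_def)
      have "inv x \<otimes> y \<in> H" using H xH yH by (simp add: subgroup.m_closed subgroup.m_inv_closed)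
      then have "inv x \<otimes> y \<in> V" using \<phi>(3)[OF V] yE by (simp add: E_def)
      then have "x \<otimes> (inv x \<otimes> y) \<in> D" using xD by (simp add: DV_def)
      moreover have "x \<in> carrier G" "y \<in> carrier G" using xH yH Hsub by auto
      then have "x \<otimes> (inv x \<otimes> y) = y" by (simp add: m_assoc[symmetric])
      ultimately show False using y by (simp add: D_def)
    qed
    then show "y \<in> (topspace T \<inter> \<Inter>\<Z>) \<inter> H"
      using yH Hsub by (auto simp: \<Z>_def topspace_eq_carrier)
  next
    fix y assume y: "y \<in> (topspace T \<inter> \<Inter>\<Z>) \<inter> H"
    then have yH: "y \<in> H" and yG: "y \<in> carrier G" using Hsub by auto
    show "y \<in> Z"
    proof (rule ccontr)
      assume "y \<notin> Z"
      then have "y \<in> D" using yH by (simp add: D_def)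
      \<comment> \<open>Continuity of left multiplication in \<open>S\<close> yields
        \<open>V\<close> with \<open>y V \<subseteq> D\<close>, so \<open>y \<in> DV V\<close>. The
        point \<open>y\<close> need not be a selected centre: equality of the unions provides one
        whose \<open>E V x\<close> contains it.\<close>
      have "openin S {v \<in> topspace S. y \<otimes> v \<in> D}"
        using openin_continuous_map_preimage[OF S.continuous_map_lmult D, of y] yH by simp
      moreover have "\<one> \<in> {v \<in> topspace S. y \<otimes> v \<in> D}"
        using \<open>y \<in> D\<close> yG subgroup.one_closed[OF H] by (simp add: topS)
      ultimately have "\<exists>V\<in>\<B>. \<one> \<in> V \<and> V \<subseteq> {v \<in> topspace S. y \<otimes> v \<in> D}" by (rule \<B>(3))
      then obtain V where V: "V \<in> \<B>" "\<one> \<in> V" "V \<subseteq> {v \<in> topspace S. y \<otimes> v \<in> D}"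
        by (elim bexE conjE)
      then have VN: "V \<in> \<N>" and "y \<in> DV V" using yH by (auto simp: \<N>_def DV_def)
      moreover have "y \<in> E V y" using \<phi>(2)[OF VN] yG by (simp add: E_def)
      ultimately obtain x where "x \<in> C V" "y \<in> E V x" using C(3)[OF VN] by blast
      then show False using y VN by (auto simp: \<Z>_def)
    qed
  qed
  ultimately show "\<exists>C. zero_set_in T C \<and> Z = C \<inter> H" by blast
qed

theorem theorem2p11:
  fixes G :: "('a, 'm) monoid_scheme" and T :: "'a topology"
  assumes "paratopological_group G T"
    and "regular_space T" and "t1_space T"
    and "R_factorizable G T"
  shows "\<forall>H. subgroup H G \<longrightarrow>
           (R_factorizable (G\<lparr>carrier := H\<rparr>) (subtopology T H) \<longleftrightarrow> z_embedded_in T H)"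
  using paratopological_group.R_factorizable_subgroup_if_z_embedded[OF assms(1,4)]
    paratopological_group.z_embedded_if_R_factorizable_subgroup[OF assms(1,2,4)] by blast

end
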